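(* Let $X$ be an ordered Banach space with cone $K$, and let $T\colon K\to K$ be a superadditive, 1-homogeneous, completely continuous map such that $\tilde{\varrho}_+(T)>0$. Then there exist $\lambda_0>0$ and $x_0\in K$ with $\|x_0\|=1$ such that $T(x_0)=\lambda_0x_0$. Moreover, if for every $x\in\partial K\setminus\{0\}$ and every $\beta>0$ one has $x-\beta T(x)\notin K$, then $x_0$ is the unique unit eigenvector of $T$ in $K$.
   Context: An ordered Banach space is a real Banach space $X$ together with a cone $K$, i.e. a nontrivial closed subset $K\subset X$ such that $tK\subset K$ for all $t\ge 0$, $K+K\subset K$, and $K\cap(-K)=\{0\}$. $\partial K$ denotes the boundary of $K$ in $X$. Write $x\preceq y$ if $y-x\in K$. A map $T\colon K\to K$ is superadditive if $T(x+y)\succeq T(x)+T(y)$ for all $x,y\in K$; 1-homogeneous if $T(tx)=tT(x)$ for all $t\ge 0$ and $x\in K$; completely continuous if it is continuous and compact (it maps bounded sets to relatively compact sets). For a continuous 1-homogeneous map $T$ set $\|T\|_+=\sup\{\|T(x)\| : x\in K,\ \|x\|\le 1\}$ and $\tilde{\varrho}_+(T)=\lim_{n\to\infty}\|T^n\|_+^{1/n}$ (Bonsall's cone spectral radius). A unit eigenvector of $T$ in $K$ is an $x\in K$ with $\|x\|=1$ and $T(x)=\lambda x$ for some $\lambda\in\mathbb{R}$. *)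

theory Defs
  imports "HOL-Analysis.Analysis"
begin

definition order_cone :: "'a::real_normed_vector set \<Rightarrow> bool" where
  "order_cone K \<longleftrightarrow>
     closed K \<and> (\<exists>x\<in>K. x \<noteq> 0) \<and> cone K \<and>
     (\<forall>x\<in>K. \<forall>y\<in>K. x + y \<in> K) \<and> K \<inter> uminus ` K = {0}"

definition cone_le :: "'a::real_normed_vector set \<Rightarrow> 'a \<Rightarrow> 'a \<Rightarrow> bool" where
  "cone_le K x y \<longleftrightarrow> y - x \<in> K"

definition superadditive_on :: "'a::real_normed_vector set \<Rightarrow> ('a \<Rightarrow> 'a) \<Rightarrow> bool" where
  "superadditive_on K T \<longleftrightarrow> (\<forall>x\<in>K. \<forall>y\<in>K. cone_le K (T x + T y) (T (x + y)))"

definition homogeneous_on :: "'a::real_normed_vector set \<Rightarrow> ('a \<Rightarrow> 'a) \<Rightarrow> bool" where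
  "homogeneous_on K T \<longleftrightarrow> (\<forall>t\<ge>0. \<forall>x\<in>K. T (t *\<^sub>R x) = t *\<^sub>R T x)"

definition completely_continuous_on :: "'a::real_normed_vector set \<Rightarrow> ('a \<Rightarrow> 'a) \<Rightarrow> bool" where
  "completely_continuous_on K T \<longleftrightarrow>
     continuous_on K T \<and> (\<forall>B. B \<subseteq> K \<longrightarrow> bounded B \<longrightarrow> compact (closure (T ` B)))"

definition cone_norm :: "'a::real_normed_vector set \<Rightarrow> ('a \<Rightarrow> 'a) \<Rightarrow> real" where
  "cone_norm K T = (SUP x\<in>{x\<in>K. norm x \<le> 1}. norm (T x))"

(* For continuous 1-homogeneous self-maps of K the supremum above is finite and n |-> cone_norm K (T ^^ n)
   is submultiplicative, so the limit below exists; elsewhere the value is unspecified. *)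
definition bonsall_radius :: "'a::real_normed_vector set \<Rightarrow> ('a \<Rightarrow> 'a) \<Rightarrow> real" where
  "bonsall_radius K T = lim (\<lambda>n. root n (cone_norm K (T ^^ n)))"

definition unit_eigenvector :: "'a::real_normed_vector set \<Rightarrow> ('a \<Rightarrow> 'a) \<Rightarrow> 'a \<Rightarrow> bool" where
  "unit_eigenvector K T x \<longleftrightarrow> x \<in> K \<and> norm x = 1 \<and> (\<exists>c::real. T x = c *\<^sub>R x)"

end

theory Submission
  imports Defs
begin

text \<open>
  Superadditivity makes \<open>T\<close> monotone. For \<open>\<mu> > 0\<close> and \<open>u \<in> K\<close>, the increasing iteration
  \<open>x \<mapsto> (T x + u) / \<mu>\<close> started at \<open>0\<close> either converges to a solution of \<open>\<mu> x = T x + u\<close>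
  or, after rescaling along record values of the norm, yields a unit \<open>y \<in> K\<close> with \<open>T y \<succeq> \<mu> y\<close>.
  If the Bonsall radius is positive, then adding up suitably weighted almost maximisers of
  \<open>T ^ n\<close> gives a \<open>u\<close> for which the equation has no solution when \<open>\<mu>\<close> is small. Hence the
  set of \<open>\<mu> > 0\<close> with \<open>T y \<succeq> \<mu> y\<close> for some \<open>y \<noteq> 0\<close> is nonempty; it has a maximum \<open>\<mu>\<^sub>0\<close>, attained
  at \<open>y\<close> say. For \<open>\<mu>\<close> decreasing to \<open>\<mu>\<^sub>0\<close> the equation \<open>\<mu> x = T x + y\<close> is solvable, its solutions
  blow up, and their normalisations accumulate at an eigenvector for \<open>\<mu>\<^sub>0\<close>.

  For uniqueness, the boundary condition puts all eigenvectors with positive eigenvalue in the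
  interior of \<open>K\<close>. Given two of them, \<open>x\<close> and \<open>y\<close>, with the eigenvalue of \<open>x\<close> not larger, subtract
  from \<open>x\<close> the largest multiple of \<open>y\<close> that stays in \<open>K\<close>; the difference \<open>z\<close> is a
  boundary point with \<open>c z \<succeq> T z\<close>, hence \<open>z = 0\<close>.
\<close>

section \<open>Closed pointed cones and compact monotone maps\<close>

locale monotone_cone_map =
  fixes K :: "'a::banach set" and T :: "'a \<Rightarrow> 'a"
  assumes closed_K: "closed K"
    and zero_K: "0 \<in> K"
    and add_K: "x \<in> K \<Longrightarrow> y \<in> K \<Longrightarrow> x + y \<in> K"
    and scale_K: "x \<in> K \<Longrightarrow> 0 \<le> t \<Longrightarrow> t *\<^sub>R x \<in> K"
    and pointed: "x \<in> K \<Longrightarrow> - x \<in> K \<Longrightarrow> x = 0"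
    and T_K: "x \<in> K \<Longrightarrow> T x \<in> K"
    and mono: "x \<in> K \<Longrightarrow> y \<in> K \<Longrightarrow> y - x \<in> K \<Longrightarrow> T y - T x \<in> K"
    and homog: "x \<in> K \<Longrightarrow> 0 \<le> t \<Longrightarrow> T (t *\<^sub>R x) = t *\<^sub>R T x"
    and cont: "continuous_on K T"
    and compact_image: "B \<subseteq> K \<Longrightarrow> bounded B \<Longrightarrow> compact (closure (T ` B))"
begin

lemma le_trans_K: "y - x \<in> K \<Longrightarrow> z - y \<in> K \<Longrightarrow> z - x \<in> K"
  using add_K[of "y - x" "z - y"] by (simp add: algebra_simps)

lemma scale_diff_K: "y - x \<in> K \<Longrightarrow> 0 \<le> t \<Longrightarrow> t *\<^sub>R y - t *\<^sub>R x \<in> K"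
  using scale_K[of "y - x" t] by (simp add: algebra_simps)

lemma limit_K:
  assumes "\<And>n::nat. f n \<in> K" "f \<longlonglongrightarrow> x"
  shows "x \<in> K"
  using closed_sequentially[OF closed_K] assms by blast

lemma limit_T:
  assumes "\<And>n::nat. f n \<in> K" "f \<longlonglongrightarrow> x"
  shows "(\<lambda>n. T (f n)) \<longlonglongrightarrow> T x"
  using continuous_on_tendsto_compose[OF cont assms(2) limit_K[OF assms]] assms(1) by simp

text \<open>In the limit \<open>- y\<close> lies in \<open>K\<close>, against pointedness. Several
  contradictions below take this form, because \<open>K\<close> is not assumed normal and so order
  bounds do not give norm bounds.\<close>

lemma not_dominated:
  assumes "y \<in> K" "y \<noteq> 0" "\<And>n::nat. f n - y \<in> K" "f \<longlonglongrightarrow> 0"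
  shows False
proof -
  have "(\<lambda>n. f n - y) \<longlonglongrightarrow> 0 - y" by (intro tendsto_intros assms)
  from limit_K[OF assms(3) this] show False using pointed assms(1,2) by simp
qed

lemma funpow_K: "x \<in> K \<Longrightarrow> (T ^^ n) x \<in> K"
  by (induction n) (auto intro: T_K)

lemma funpow_homog: "x \<in> K \<Longrightarrow> 0 \<le> t \<Longrightarrow> (T ^^ n) (t *\<^sub>R x) = t *\<^sub>R (T ^^ n) x"
  by (induction n) (auto simp: homog funpow_K)

lemma funpow_mono: "x \<in> K \<Longrightarrow> y \<in> K \<Longrightarrow> y - x \<in> K \<Longrightarrow> (T ^^ n) y - (T ^^ n) x \<in> K"
  by (induction n) (auto intro: mono funpow_K)

text \<open>Compactness acts on the images only; the \<open>p n\<close> themselves are merely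
  bounded. Later arguments therefore express the vectors of interest through images
  \<open>T (p n)\<close>.\<close>

lemma convergent_image_subseq:
  assumes "\<And>n. p n \<in> K" "\<And>n. norm (p n) \<le> R"
  obtains r :: "nat \<Rightarrow> nat" and z
  where "strict_mono r" "(\<lambda>n. T (p (r n))) \<longlonglongrightarrow> z" "z \<in> K"
proof -
  have "compact (closure (T ` range p))"
    using assms by (intro compact_image) (auto simp: bounded_iff)
  moreover have "\<forall>n. T (p n) \<in> closure (T ` range p)"
    by (auto intro: subsetD[OF closure_subset])
  ultimately obtain z r where r: "strict_mono r" "((\<lambda>n. T (p n)) \<circ> r) \<longlonglongrightarrow> z"
    unfolding compact_def by metis
  then have "(\<lambda>n. T (p (r n))) \<longlonglongrightarrow> z" by (simp add: o_def)
  moreover from this have "z \<in> K"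
    by (rule limit_K[OF T_K[OF assms(1)]])
  ultimately show thesis using r that by blast
qed

lemma T_bounded:
  obtains B where "B > 0" "\<And>x. x \<in> K \<Longrightarrow> norm (T x) \<le> B * norm x"
proof -
  have "compact (closure (T ` {x\<in>K. norm x \<le> 1}))"
    by (intro compact_image) (auto simp: bounded_iff)
  then have "bounded (T ` {x\<in>K. norm x \<le> 1})"
    by (meson bounded_subset closure_subset compact_imp_bounded)
  then obtain B where B: "B > 0" "\<And>x. x \<in> K \<Longrightarrow> norm x \<le> 1 \<Longrightarrow> norm (T x) \<le> B"
    by (auto simp: bounded_pos)
  have "norm (T x) \<le> B * norm x" if "x \<in> K" for x
  proof (cases "x = 0")
    case True
    then show ?thesis using homog[of 0 0] zero_K by simp
  next
    case False
    have "T x = norm x *\<^sub>R T ((1 / norm x) *\<^sub>R x)"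
      using homog[OF that, of "1 / norm x"] False by simp
    moreover have "norm (T ((1 / norm x) *\<^sub>R x)) \<le> B"
      using B(2)[of "(1 / norm x) *\<^sub>R x"] scale_K[OF that, of "1 / norm x"] by simp
    ultimately show ?thesis
      by (metis abs_norm_cancel mult.commute mult_left_mono norm_ge_zero norm_scaleR)
  qed
  with B(1) show thesis using that by blast
qed

section \<open>Solvability of the equation \<open>\<mu> *\<^sub>R x = T x + u\<close>\<close>

lemma solution_or_subeigenvector:
  assumes "\<mu> > 0" "u \<in> K"
  shows "(\<exists>x\<in>K. \<mu> *\<^sub>R x = T x + u) \<or> (\<exists>y\<in>K. norm y = 1 \<and> T y - \<mu> *\<^sub>R y \<in> K)"
proof -
  define F where "F x = (1 / \<mu>) *\<^sub>R (T x + u)" for x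
  define x where "x n = (F ^^ n) 0" for n
  have x_Suc: "x (Suc n) = F (x n)" for n by (simp add: x_def)
  have \<mu>x: "\<mu> *\<^sub>R x (Suc n) = T (x n) + u" for n
    using assms(1) by (simp add: x_Suc F_def)
  have xK: "x n \<in> K" for n
  proof (induction n)
    case 0 show ?case by (simp add: x_def zero_K)
  next
    case (Suc n) then show ?case
      using assms by (auto simp: x_Suc F_def intro!: scale_K add_K T_K)
  qed
  have incr: "x (Suc n) - x n \<in> K" for n
  proof (induction n)
    case 0 show ?case using xK[of 1] by (simp add: x_def)
  next
    case (Suc n)
    have "x (Suc (Suc n)) - x (Suc n) = (1 / \<mu>) *\<^sub>R (T (x (Suc n)) - T (x n))"
      by (simp only: x_Suc[of "Suc n"] x_Suc[of n] F_def) (simp add: algebra_simps)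
    then show ?case using assms Suc xK by (simp add: scale_K mono)
  qed
  have incr': "x n - x m \<in> K" if "m \<le> n" for m n
    using that
  proof (induction n rule: dec_induct)
    case base show ?case by (simp add: zero_K)
  next
    case (step n) then show ?case using le_trans_K incr by blast
  qed
  show ?thesis
  proof (cases "\<exists>R. \<forall>n. norm (x n) \<le> R")
    case True
    then obtain R where "\<And>n. norm (x n) \<le> R" by blast
    then obtain r z where r: "strict_mono r" "(\<lambda>n. T (x (r n))) \<longlonglongrightarrow> z"
      using convergent_image_subseq[of x R] xK by metis
    define w where "w = (1 / \<mu>) *\<^sub>R (z + u)"
    have lim1: "(\<lambda>n. x (Suc (r n))) \<longlonglongrightarrow> w"
      unfolding x_Suc F_def w_def by (intro tendsto_intros r)
    have wK: "w \<in> K" by (rule limit_K[OF xK lim1])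
    have "(\<lambda>n. T (x (Suc (r n)))) \<longlonglongrightarrow> T w"
      using lim1 xK by (intro limit_T)
    then have lim2: "(\<lambda>n. x (Suc (Suc (r n)))) \<longlonglongrightarrow> F w"
      unfolding x_Suc[of "Suc _"] F_def by (intro tendsto_intros)
    have "F w - w \<in> K"
      by (rule limit_K[OF _ tendsto_diff[OF lim2 lim1]]) (rule incr)
    \<comment> \<open>Interlacing: the index \<open>Suc (r (n + 2))\<close> is no earlier than
      \<open>Suc (Suc (r n))\<close>, so the sequence tending to \<open>w\<close> dominates the one
      tending to \<open>F w\<close>.\<close>
    moreover have "w - F w \<in> K"
    proof -
      have sub: "(\<lambda>n. x (Suc (r (n + 2)))) \<longlonglongrightarrow> w"
        using LIMSEQ_ignore_initial_segment[OF lim1, of 2] by simp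
      have "Suc (Suc (r n)) \<le> Suc (r (n + 2))" for n
        using strict_monoD[OF r(1), of n "n + 2"] by simp
      then show ?thesis
        by (rule limit_K[OF incr' tendsto_diff[OF sub lim2]])
    qed
    ultimately have "F w = w" using pointed[of "F w - w"] by simp
    then have "\<mu> *\<^sub>R w = \<mu> *\<^sub>R F w" by simp
    then have "\<mu> *\<^sub>R w = T w + u" using assms(1) by (simp add: F_def)
    then show ?thesis using wK by blast
  next
    case False
    \<comment> \<open>\<open>x (Suc k)\<close> is the first iterate of norm above \<open>n\<close>;
      it has a predecessor because \<open>x 0 = 0\<close>. Dividing both by the norm of
      \<open>x (Suc k)\<close> keeps the predecessor in the unit ball.\<close>
    have "\<exists>k. norm (x k) \<le> real n \<and> real n < norm (x (Suc k))" for n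
    proof -
      define P where "P k \<longleftrightarrow> real n < norm (x k)" for k
      have "\<exists>k. P k" using False by (auto simp: P_def not_le)
      then have P: "P (LEAST k. P k)" by (rule LeastI_ex)
      have "\<not> P 0" by (simp add: P_def x_def)
      then obtain k where k: "(LEAST k. P k) = Suc k"
        using P by (metis not0_implies_Suc)
      then have "\<not> P k" using not_less_Least[of k P] by simp
      then show ?thesis using P k by (auto simp: P_def not_less)
    qed
    then obtain k where k: "\<And>n. norm (x (k n)) \<le> real n" "\<And>n. real n < norm (x (Suc (k n)))"
      by metis
    define t where "t n = 1 / norm (x (Suc (k n)))" for n
    have t_pos: "t n > 0" for n
      using k(2)[of n] by (auto simp: t_def intro: le_less_trans[of 0 "real n"])
    have t_lim: "t \<longlonglongrightarrow> 0"
    proof (rule tendsto_sandwich[of "\<lambda>_. 0" _ _ "\<lambda>n. 1 / real n"])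
      show "\<forall>\<^sub>F n in sequentially. t n \<le> 1 / real n"
        using eventually_gt_at_top[of 0]
      proof eventually_elim
        case (elim n)
        then show ?case using k(2)[of n] unfolding t_def by (intro frac_le) auto
      qed
    qed (use less_imp_le[OF t_pos] in \<open>auto simp: lim_1_over_n\<close>)
    define p where "p n = t n *\<^sub>R x (k n)" for n
    define y where "y n = t n *\<^sub>R x (Suc (k n))" for n
    have pK: "p n \<in> K" and yK: "y n \<in> K" for n
      using t_pos[of n] xK unfolding p_def y_def by (auto intro: scale_K)
    have norm_p: "norm (p n) \<le> 1" and norm_y: "norm (y n) = 1" for n
      using k(1)[of n] k(2)[of n] t_pos[of n]
      by (auto simp: p_def y_def t_def divide_le_eq)
    have y_eq: "y n = (1 / \<mu>) *\<^sub>R (T (p n) + t n *\<^sub>R u)" for n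
    proof -
      have "\<mu> *\<^sub>R y n = t n *\<^sub>R (\<mu> *\<^sub>R x (Suc (k n)))" by (simp add: y_def)
      also have "\<dots> = T (p n) + t n *\<^sub>R u"
        using t_pos[of n] xK by (simp add: \<mu>x p_def homog scaleR_add_right)
      finally have "(1 / \<mu>) *\<^sub>R (\<mu> *\<^sub>R y n) = (1 / \<mu>) *\<^sub>R (T (p n) + t n *\<^sub>R u)" by simp
      then show ?thesis using assms(1) by simp
    qed
    \<comment> \<open>\<open>p n\<close> precedes \<open>y n\<close> in the rescaled increasing
      sequence. Along a subsequence \<open>T (p n)\<close> tends to \<open>\<mu>\<close> times the
      limit of \<open>y n\<close>, since the term with \<open>u\<close> vanishes, so this becomes
      the inequality for the limit.\<close>
    have Typ: "T (y n) - T (p n) \<in> K" for n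
      using t_pos[of n] incr unfolding p_def y_def
      by (intro mono scale_diff_K scale_K xK) auto
    obtain r z where r: "strict_mono r" "(\<lambda>n. T (p (r n))) \<longlonglongrightarrow> z"
      using convergent_image_subseq[of p 1] pK norm_p by metis
    have t_r: "(\<lambda>n. t (r n)) \<longlonglongrightarrow> 0"
      using LIMSEQ_subseq_LIMSEQ[OF t_lim r(1)] by (simp add: o_def)
    have y_lim: "(\<lambda>n. y (r n)) \<longlonglongrightarrow> (1 / \<mu>) *\<^sub>R (z + 0 *\<^sub>R u)" (is "_ \<longlonglongrightarrow> ?y")
      unfolding y_eq by (intro tendsto_intros r t_r)
    have "?y \<in> K" by (rule limit_K[OF yK y_lim])
    moreover have "(\<lambda>n. norm (y (r n))) \<longlonglongrightarrow> 1" by (simp add: norm_y)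
    then have "norm ?y = 1" using LIMSEQ_unique[OF tendsto_norm[OF y_lim]] by blast
    moreover have "T ?y - \<mu> *\<^sub>R ?y \<in> K"
    proof -
      have "(\<lambda>n. T (y (r n)) - T (p (r n))) \<longlonglongrightarrow> T ?y - z"
        by (intro tendsto_diff limit_T y_lim r yK)
      from limit_K[OF _ this] Typ show ?thesis using assms(1) by simp
    qed
    ultimately show ?thesis by blast
  qed
qed

section \<open>The largest \<open>\<mu>\<close> admitting a sub-eigenvector\<close>

text \<open>Prepares sub-eigenvectors for compactness by making them images of bounded vectors. The
  iterates \<open>z n\<close> of \<open>T\<close> divided by \<open>\<mu>\<close> increase and stay
  above \<open>y\<close>, so their norms cannot halve at every step. At an \<open>n\<close> where
  they do not, a multiple of \<open>z n\<close> serves as \<open>p\<close>.\<close>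

lemma subeigenvector_in_image:
  assumes "\<mu> > 0" "y \<in> K" "y \<noteq> 0" "T y - \<mu> *\<^sub>R y \<in> K"
  shows "\<exists>p\<in>K. norm p \<le> 2 / \<mu> \<and> norm (T p) = 1 \<and> T (T p) - \<mu> *\<^sub>R T p \<in> K"
proof -
  define z where "z n = (1 / \<mu>) ^ n *\<^sub>R (T ^^ n) y" for n
  have zK: "z n \<in> K" for n
    using assms by (auto simp: z_def intro!: scale_K funpow_K)
  have z_Suc: "z (Suc n) = (1 / \<mu>) *\<^sub>R T (z n)" for n
    using assms by (simp add: z_def homog funpow_K)
  have incr: "z (Suc n) - z n \<in> K" for n
  proof (induction n)
    case 0
    have "z (Suc 0) - z 0 = (1 / \<mu>) *\<^sub>R (T y - \<mu> *\<^sub>R y)"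
      using assms by (simp add: z_def algebra_simps)
    then show ?case using assms by (auto intro: scale_K)
  next
    case (Suc n)
    have "z (Suc (Suc n)) - z (Suc n) = (1 / \<mu>) *\<^sub>R (T (z (Suc n)) - T (z n))"
      by (simp only: z_Suc[of "Suc n"] z_Suc[of n]) (simp add: algebra_simps)
    then show ?case using assms Suc zK by (simp add: scale_K mono)
  qed
  have zy: "z n - y \<in> K" for n
  proof (induction n)
    case 0 show ?case by (simp add: z_def zero_K)
  next
    case (Suc n) then show ?case using le_trans_K incr by blast
  qed
  have z_nonzero: "z n \<noteq> 0" for n
    using zy[of n] assms(2,3) pointed by auto
  have "\<exists>n. norm (z n) \<le> 2 * norm (z (Suc n))"
  proof (rule ccontr)
    assume "\<not> ?thesis"
    then have less: "2 * norm (z (Suc n)) < norm (z n)" for n by (simp add: not_le)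
    have *: "norm (z (Suc n)) \<le> (1 / 2) * norm (z n)" for n
      using less[of n] by simp
    have bd: "norm (z n) \<le> (1 / 2) ^ n * norm y" for n
    proof (induction n)
      case 0 show ?case by (simp add: z_def)
    next
      case (Suc n)
      show ?case using order_trans[OF *[of n] mult_left_mono[OF Suc, of "1 / 2"]] by simp
    qed
    have "(\<lambda>n. (1 / 2) ^ n * norm y) \<longlonglongrightarrow> 0 * norm y"
      by (intro tendsto_mult LIMSEQ_power_zero tendsto_const) auto
    then have "z \<longlonglongrightarrow> 0"
      using bd by (intro Lim_null_comparison[of z]) auto
    then show False by (rule not_dominated[OF assms(2,3) zy])
  qed
  then obtain n where n: "norm (z n) \<le> 2 * norm (z (Suc n))" by blast
  define s where "s = 1 / norm (z (Suc n))"
  have s: "s > 0" using z_nonzero by (simp add: s_def)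
  define p where "p = (s / \<mu>) *\<^sub>R z n"
  have Tp: "T p = s *\<^sub>R z (Suc n)"
    using s assms zK by (simp add: p_def homog z_Suc)
  have "p \<in> K" using s assms zK by (auto simp: p_def intro: scale_K)
  moreover have "norm p \<le> 2 / \<mu>"
    using n assms z_nonzero[of "Suc n"] s by (simp add: p_def s_def field_simps)
  moreover have "norm (T p) = 1" using z_nonzero[of "Suc n"] by (simp add: Tp s_def)
  moreover have "T (T p) - \<mu> *\<^sub>R T p \<in> K"
  proof -
    have "T (T p) = (s * \<mu>) *\<^sub>R z (Suc (Suc n))"
      using s assms zK by (simp add: Tp homog z_Suc[of "Suc n"])
    then have "T (T p) - \<mu> *\<^sub>R T p = (s * \<mu>) *\<^sub>R (z (Suc (Suc n)) - z (Suc n))"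
      by (simp add: Tp algebra_simps)
    then show ?thesis using s assms incr by (auto intro: scale_K)
  qed
  ultimately show ?thesis by blast
qed

text \<open>Applying the norm bound of \<open>T\<close> to the preimages \<open>p\<close> bounds the
  admissible \<open>\<mu>\<close>. As \<open>\<mu>\<close> approaches the supremum, the unit vectors
  \<open>T p\<close> accumulate at a unit vector, so the supremum is attained.\<close>

lemma maximal_subeigenvector:
  assumes "\<mu>\<^sub>1 > 0" "y\<^sub>1 \<in> K" "y\<^sub>1 \<noteq> 0" "T y\<^sub>1 - \<mu>\<^sub>1 *\<^sub>R y\<^sub>1 \<in> K"
  obtains \<mu>\<^sub>0 y where "\<mu>\<^sub>0 > 0" "y \<in> K" "y \<noteq> 0" "T y - \<mu>\<^sub>0 *\<^sub>R y \<in> K"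
    "\<And>\<mu> v. v \<in> K \<Longrightarrow> v \<noteq> 0 \<Longrightarrow> T v - \<mu> *\<^sub>R v \<in> K \<Longrightarrow> \<mu> \<le> \<mu>\<^sub>0"
proof -
  define S where "S = {\<mu>. \<mu> > 0 \<and> (\<exists>y\<in>K. y \<noteq> 0 \<and> T y - \<mu> *\<^sub>R y \<in> K)}"
  have "\<mu>\<^sub>1 \<in> S" using assms by (auto simp: S_def)
  obtain B where B: "B > 0" "\<And>x. x \<in> K \<Longrightarrow> norm (T x) \<le> B * norm x"
    using T_bounded by blast
  have "\<mu> \<le> 2 * B" if \<mu>: "\<mu> \<in> S" for \<mu>
  proof -
    obtain p where p: "p \<in> K" "norm p \<le> 2 / \<mu>" "norm (T p) = 1"
      using \<mu> subeigenvector_in_image by (auto simp: S_def)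
    have "1 \<le> B * (2 / \<mu>)"
      using B(2)[OF p(1)] p mult_left_mono[OF p(2), of B] B(1) by simp
    then show ?thesis using \<mu> by (simp add: S_def field_simps)
  qed
  then have bdd: "bdd_above S" by (rule bdd_aboveI)
  define \<mu>\<^sub>0 where "\<mu>\<^sub>0 = Sup S"
  have ub: "\<mu> \<le> \<mu>\<^sub>0" if "\<mu> \<in> S" for \<mu>
    using cSup_upper[OF that bdd] by (simp add: \<mu>\<^sub>0_def)
  have \<mu>\<^sub>0_pos: "\<mu>\<^sub>0 > 0" using ub[OF \<open>\<mu>\<^sub>1 \<in> S\<close>] assms(1) by simp
  \<comment> \<open>The factor tends to 1 but is never below 1/2, so all \<open>m n\<close> are at
    least half the supremum and the preimages below share one norm bound.\<close>
  have "\<exists>\<mu>\<in>S. \<mu>\<^sub>0 * (1 - 1 / (2 + real n)) < \<mu>" for n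
  proof -
    have "\<mu>\<^sub>0 * (1 - 1 / (2 + real n)) < \<mu>\<^sub>0" using \<mu>\<^sub>0_pos by (simp add: field_simps)
    then show ?thesis using less_cSup_iff[of S] bdd \<open>\<mu>\<^sub>1 \<in> S\<close> unfolding \<mu>\<^sub>0_def by blast
  qed
  then obtain m where m: "\<And>n. m n \<in> S" "\<And>n. \<mu>\<^sub>0 * (1 - 1 / (2 + real n)) < m n" by metis
  have m_half: "\<mu>\<^sub>0 / 2 \<le> m n" for n
  proof -
    have "\<mu>\<^sub>0 * (1 / 2) \<le> \<mu>\<^sub>0 * (1 - 1 / (2 + real n))"
      using \<mu>\<^sub>0_pos by (intro mult_left_mono) (auto simp: field_simps)
    with m(2)[of n] show ?thesis by linarith
  qed
  have m_lim: "m \<longlonglongrightarrow> \<mu>\<^sub>0"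
  proof (rule tendsto_sandwich[of "\<lambda>n. \<mu>\<^sub>0 * (1 - 1 / (2 + real n))" _ _ "\<lambda>_. \<mu>\<^sub>0"])
    have "(\<lambda>n. 1 / (2 + real n)) \<longlonglongrightarrow> 0"
      using LIMSEQ_ignore_initial_segment[OF lim_1_over_n[where 'a = real], of 2]
      by (simp add: add.commute)
    then have "(\<lambda>n. \<mu>\<^sub>0 * (1 - 1 / (2 + real n))) \<longlonglongrightarrow> \<mu>\<^sub>0 * (1 - 0)"
      by (intro tendsto_intros)
    then show "(\<lambda>n. \<mu>\<^sub>0 * (1 - 1 / (2 + real n))) \<longlonglongrightarrow> \<mu>\<^sub>0" by simp
  qed (use m ub in \<open>auto intro: less_imp_le always_eventually\<close>)
  have "\<exists>p\<in>K. norm p \<le> 4 / \<mu>\<^sub>0 \<and> norm (T p) = 1 \<and> T (T p) - m n *\<^sub>R T p \<in> K" for n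
  proof -
    obtain p where p: "p \<in> K" "norm p \<le> 2 / m n" "norm (T p) = 1" "T (T p) - m n *\<^sub>R T p \<in> K"
      using m(1)[of n] subeigenvector_in_image by (auto simp: S_def)
    have "2 / m n \<le> 2 / (\<mu>\<^sub>0 / 2)"
      using m_half[of n] \<mu>\<^sub>0_pos by (intro divide_left_mono) auto
    then have "norm p \<le> 4 / \<mu>\<^sub>0" using p(2) by simp
    then show ?thesis using p by blast
  qed
  then obtain p where p: "\<And>n. p n \<in> K" "\<And>n. norm (p n) \<le> 4 / \<mu>\<^sub>0" "\<And>n. norm (T (p n)) = 1"
    "\<And>n. T (T (p n)) - m n *\<^sub>R T (p n) \<in> K" by metis
  obtain r z where r: "strict_mono r" "(\<lambda>n. T (p (r n))) \<longlonglongrightarrow> z" "z \<in> K"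
    by (rule convergent_image_subseq[OF p(1,2)])
  have "norm z = 1" using tendsto_norm[OF r(2)] by (simp add: p LIMSEQ_const_iff)
  then have "z \<noteq> 0" by auto
  have "(\<lambda>n. m (r n)) \<longlonglongrightarrow> \<mu>\<^sub>0"
    using LIMSEQ_subseq_LIMSEQ[OF m_lim r(1)] by (simp add: o_def)
  then have "(\<lambda>n. T (T (p (r n))) - m (r n) *\<^sub>R T (p (r n))) \<longlonglongrightarrow> T z - \<mu>\<^sub>0 *\<^sub>R z"
    by (intro tendsto_intros limit_T r) (use p T_K in auto)
  from limit_K[OF _ this] p(4) have Tz: "T z - \<mu>\<^sub>0 *\<^sub>R z \<in> K" by blast
  have "\<mu> \<le> \<mu>\<^sub>0" if "v \<in> K" "v \<noteq> 0" "T v - \<mu> *\<^sub>R v \<in> K" for \<mu> v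
    using ub[of \<mu>] \<mu>\<^sub>0_pos that by (cases "\<mu> > 0") (auto simp: S_def)
  then show thesis using that \<mu>\<^sub>0_pos r(3) \<open>z \<noteq> 0\<close> Tz by blast
qed

section \<open>From the largest sub-eigenvalue to an eigenvector\<close>

text \<open>If \<open>x\<close> dominates \<open>s *\<^sub>R y\<close>, then \<open>T x\<close>
  dominates \<open>(s * \<nu>) *\<^sub>R y\<close>, and the equation improves the coefficient to
  \<open>(\<nu> * s + t) / \<mu>\<close>. Starting from 0, these coefficients converge to the fixed
  point \<open>t / (\<mu> - \<nu>)\<close>; the \<open>s n\<close> of the proof is their closed
  form.\<close>

lemma resolvent_lower_bound:
  assumes "0 \<le> \<nu>" "\<nu> < \<mu>" "x \<in> K" "y \<in> K" "0 \<le> t"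
    "\<mu> *\<^sub>R x = T x + t *\<^sub>R y" "T y - \<nu> *\<^sub>R y \<in> K"
  shows "x - (t / (\<mu> - \<nu>)) *\<^sub>R y \<in> K"
proof -
  define s where "s n = (t / (\<mu> - \<nu>)) * (1 - (\<nu> / \<mu>) ^ n)" for n
  have \<mu>: "\<mu> > 0" using assms by simp
  have s_nonneg: "s n \<ge> 0" for n
    using assms unfolding s_def
    by (intro mult_nonneg_nonneg divide_nonneg_nonneg) (auto intro!: power_le_one)
  have s_Suc: "s (Suc n) = (\<nu> * s n + t) / \<mu>" for n
    using assms by (simp add: s_def field_simps)
  have "x - s n *\<^sub>R y \<in> K" for n
  proof (induction n)
    case 0 show ?case using assms by (simp add: s_def)
  next
    case (Suc n)
    have 1: "T x - s n *\<^sub>R T y \<in> K"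
      using mono[OF scale_K[OF assms(4) s_nonneg[of n]] assms(3) Suc]
      by (simp add: homog assms s_nonneg)
    have 2: "s n *\<^sub>R T y - s n *\<^sub>R \<nu> *\<^sub>R y \<in> K"
      by (intro scale_diff_K assms s_nonneg)
    have "(1 / \<mu>) *\<^sub>R (T x - s n *\<^sub>R \<nu> *\<^sub>R y) \<in> K"
      using le_trans_K[OF 2 1] \<mu> by (intro scale_K) auto
    moreover have "(1 / \<mu>) *\<^sub>R (T x - s n *\<^sub>R \<nu> *\<^sub>R y) = x - s (Suc n) *\<^sub>R y"
    proof -
      have "T x = \<mu> *\<^sub>R x - t *\<^sub>R y" using assms(6) by simp
      then have "T x - s n *\<^sub>R \<nu> *\<^sub>R y = \<mu> *\<^sub>R x - (\<nu> * s n + t) *\<^sub>R y"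
        by (simp only:) (simp add: algebra_simps)
      then have "(1 / \<mu>) *\<^sub>R (T x - s n *\<^sub>R \<nu> *\<^sub>R y) = (1 / \<mu>) *\<^sub>R (\<mu> *\<^sub>R x - (\<nu> * s n + t) *\<^sub>R y)"
        by simp
      also have "\<dots> = x - s (Suc n) *\<^sub>R y" using \<mu> by (simp add: s_Suc scaleR_diff_right)
      finally show ?thesis .
    qed
    ultimately show ?case by simp
  qed
  moreover have "(\<lambda>n. x - s n *\<^sub>R y) \<longlonglongrightarrow> x - (t / (\<mu> - \<nu>) * (1 - 0)) *\<^sub>R y"
    unfolding s_def using assms by (intro tendsto_intros LIMSEQ_power_zero) auto
  ultimately show ?thesis using limit_K by fastforce
qed

lemma eigenvector_of_subeigenvector:
  assumes "\<mu>\<^sub>1 > 0" "y\<^sub>1 \<in> K" "y\<^sub>1 \<noteq> 0" "T y\<^sub>1 - \<mu>\<^sub>1 *\<^sub>R y\<^sub>1 \<in> K"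
  shows "\<exists>\<mu>>0. \<exists>x\<in>K. norm x = 1 \<and> T x = \<mu> *\<^sub>R x"
proof -
  obtain \<nu> y where \<nu>: "\<nu> > 0" and y: "y \<in> K" "y \<noteq> 0" "T y - \<nu> *\<^sub>R y \<in> K"
    and max: "\<And>\<mu> v. v \<in> K \<Longrightarrow> v \<noteq> 0 \<Longrightarrow> T v - \<mu> *\<^sub>R v \<in> K \<Longrightarrow> \<mu> \<le> \<nu>"
    using maximal_subeigenvector[OF assms] by blast
  define h where "h n = 1 / real (Suc n)" for n
  have h: "h n > 0" for n by (simp add: h_def)
  have h_lim: "h \<longlonglongrightarrow> 0"
    unfolding h_def using LIMSEQ_inverse_real_of_nat by (simp add: inverse_eq_divide)
  \<comment> \<open>Maximality of \<open>\<nu>\<close> excludes sub-eigenvectors for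
    \<open>\<nu> + h n\<close>, so the equation with right-hand side \<open>y\<close> is solvable.
    After normalisation \<open>t\<close> is the reciprocal of the norm of the solution.\<close>
  have "\<exists>x\<in>K. \<exists>t\<ge>0. norm x = 1 \<and> (\<nu> + h n) *\<^sub>R x = T x + t *\<^sub>R y" for n
  proof -
    have "\<not> (\<exists>v\<in>K. norm v = 1 \<and> T v - (\<nu> + h n) *\<^sub>R v \<in> K)"
      using max[of _ "\<nu> + h n"] h[of n] by fastforce
    then obtain x where x: "x \<in> K" "(\<nu> + h n) *\<^sub>R x = T x + y"
      using solution_or_subeigenvector[of "\<nu> + h n" y] \<nu> h[of n] y by auto
    have "x \<noteq> 0"
    proof
      assume "x = 0"
      then have "y = - T x" using x(2) by (simp add: eq_neg_iff_add_eq_0 add.commute)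
      then show False using y pointed T_K x(1) by (metis minus_minus)
    qed
    have "(\<nu> + h n) *\<^sub>R ((1 / norm x) *\<^sub>R x) = (1 / norm x) *\<^sub>R ((\<nu> + h n) *\<^sub>R x)"
      by (simp add: mult.commute)
    also have "\<dots> = T ((1 / norm x) *\<^sub>R x) + (1 / norm x) *\<^sub>R y"
      using x(1) by (simp only: x(2) scaleR_add_right) (simp add: homog)
    finally have "(\<nu> + h n) *\<^sub>R ((1 / norm x) *\<^sub>R x) = T ((1 / norm x) *\<^sub>R x) + (1 / norm x) *\<^sub>R y" .
    then show ?thesis using x(1) \<open>x \<noteq> 0\<close>
      by (intro bexI[of _ "(1 / norm x) *\<^sub>R x"] exI[of _ "1 / norm x"]) (auto intro: scale_K)
  qed
  then obtain w t where w: "\<And>n. w n \<in> K" "\<And>n. norm (w n) = 1" and t: "\<And>n. 0 \<le> t n"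
    and w_eq: "\<And>n. (\<nu> + h n) *\<^sub>R w n = T (w n) + t n *\<^sub>R y" by metis
  have wy: "w n - (t n / h n) *\<^sub>R y \<in> K" for n
    using resolvent_lower_bound[OF _ _ w(1) y(1) t w_eq y(3)] \<nu> h[of n] by simp
  \<comment> \<open>This is the blow-up of the solutions. If \<open>t\<close> stayed above
    \<open>e\<close> along a subsequence, the vectors \<open>w\<close> scaled by
    \<open>h / t\<close> would dominate \<open>y\<close> and tend to 0.\<close>
  have "t \<longlonglongrightarrow> 0"
  proof (rule ccontr)
    assume "\<not> t \<longlonglongrightarrow> 0"
    then obtain e where e: "e > 0" "\<And>N. \<exists>n\<ge>N. e \<le> t n"
      using t by (auto simp: LIMSEQ_iff not_less)
    then obtain j where j: "\<And>N. j N \<ge> N" "\<And>N. e \<le> t (j N)" by metis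
    define f where "f N = (h (j N) / t (j N)) *\<^sub>R w (j N)" for N
    have "f N - y \<in> K" for N
    proof -
      have "h (j N) / t (j N) * (t (j N) / h (j N)) = 1" and "h (j N) / t (j N) \<ge> 0"
        using h[of "j N"] j(2)[of N] e(1) by auto
      then show ?thesis
        using scale_diff_K[OF wy, of "h (j N) / t (j N)" "j N"]
        unfolding f_def scaleR_scaleR by simp
    qed
    moreover have "f \<longlonglongrightarrow> 0"
    proof (rule Lim_null_comparison[of _ "\<lambda>N. h N / e"])
      have "norm (f N) \<le> h N / e" for N
        using h[of "j N"] j[of N] e(1) t[of "j N"]
        by (auto simp: f_def w h_def intro!: frac_le mult_mono)
      then show "\<forall>\<^sub>F N in sequentially. norm (f N) \<le> h N / e" by simp
      show "(\<lambda>N. h N / e) \<longlonglongrightarrow> 0" using tendsto_divide[OF h_lim tendsto_const, of e] e by simp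
    qed
    ultimately show False by (rule not_dominated[OF y(1,2)])
  qed
  obtain r z where r: "strict_mono r" "(\<lambda>n. T (w (r n))) \<longlonglongrightarrow> z"
    using convergent_image_subseq[of w 1] w by (metis order_refl)
  have t_r: "(\<lambda>n. t (r n)) \<longlonglongrightarrow> 0" and h_r: "(\<lambda>n. h (r n)) \<longlonglongrightarrow> 0"
    using LIMSEQ_subseq_LIMSEQ[OF \<open>t \<longlonglongrightarrow> 0\<close> r(1)] LIMSEQ_subseq_LIMSEQ[OF h_lim r(1)]
    by (simp_all add: o_def)
  \<comment> \<open>Solving for \<open>w n\<close> transfers the convergence of the images
    \<open>T (w (r n))\<close> to the vectors \<open>w (r n)\<close> themselves.\<close>
  have w_eq': "w n = (1 / (\<nu> + h n)) *\<^sub>R (T (w n) + t n *\<^sub>R y)" for n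
    using \<nu> h[of n] by (simp flip: w_eq)
  have w_lim: "(\<lambda>n. w (r n)) \<longlonglongrightarrow> (1 / (\<nu> + 0)) *\<^sub>R (z + 0 *\<^sub>R y)" (is "_ \<longlonglongrightarrow> ?x")
    by (subst w_eq') (intro tendsto_intros r t_r h_r, use \<nu> in auto)
  have "T ?x = z"
    using LIMSEQ_unique[OF limit_T[OF _ w_lim] r(2)] w(1) by blast
  then have "T ?x = \<nu> *\<^sub>R ?x" using \<nu> by (simp only:) simp
  moreover have "?x \<in> K" using limit_K[OF _ w_lim] w(1) by blast
  moreover have "(\<lambda>n. norm (w (r n))) \<longlonglongrightarrow> 1" by (simp add: w)
  then have "norm ?x = 1" using LIMSEQ_unique[OF tendsto_norm[OF w_lim]] by blast
  ultimately show ?thesis using \<nu> by blast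
qed

section \<open>Growth of the powers of \<open>T\<close> and the Bonsall radius\<close>

text \<open>A power of the norm bound of \<open>T\<close> bounds the set under the supremum, which
  makes \<open>cone_norm\<close> meaningful. The factor 2 allows for a supremum that is not
  attained; when it is 0, the zero vector serves.\<close>

lemma cone_norm_bounds:
  shows cone_norm_upper: "x \<in> K \<Longrightarrow> norm x \<le> 1 \<Longrightarrow> norm ((T ^^ n) x) \<le> cone_norm K (T ^^ n)"
    and cone_norm_nonneg: "0 \<le> cone_norm K (T ^^ n)"
    and cone_norm_almost_attained:
      "\<exists>x\<in>K. norm x \<le> 1 \<and> cone_norm K (T ^^ n) \<le> 2 * norm ((T ^^ n) x)"
proof -
  obtain B where B: "B > 0" "\<And>x. x \<in> K \<Longrightarrow> norm (T x) \<le> B * norm x"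
    using T_bounded by blast
  have "norm ((T ^^ n) x) \<le> B ^ n * norm x" if "x \<in> K" for x
  proof (induction n)
    case 0 show ?case by simp
  next
    case (Suc n)
    have "norm ((T ^^ Suc n) x) \<le> B * norm ((T ^^ n) x)" using B(2)[OF funpow_K[OF that]] by simp
    also have "\<dots> \<le> B * (B ^ n * norm x)" using Suc B(1) by (intro mult_left_mono) auto
    finally show ?case by (simp add: mult.assoc)
  qed
  then have "norm ((T ^^ n) x) \<le> B ^ n" if "x \<in> K" "norm x \<le> 1" for x
    using order_trans[OF _ mult_left_mono[of "norm x" 1 "B ^ n"]] that B(1) by simp
  then have bdd: "bdd_above ((\<lambda>x. norm ((T ^^ n) x)) ` {x\<in>K. norm x \<le> 1})"
    by (intro bdd_aboveI2) auto
  show upper: "norm ((T ^^ n) x) \<le> cone_norm K (T ^^ n)" if "x \<in> K" "norm x \<le> 1" for x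
    unfolding cone_norm_def using that by (intro cSUP_upper bdd) auto
  show nonneg: "0 \<le> cone_norm K (T ^^ n)"
    using order_trans[OF norm_ge_zero upper[OF zero_K]] by simp
  show "\<exists>x\<in>K. norm x \<le> 1 \<and> cone_norm K (T ^^ n) \<le> 2 * norm ((T ^^ n) x)"
  proof (cases "cone_norm K (T ^^ n) = 0")
    case True
    then show ?thesis using zero_K by (intro bexI[of _ 0]) auto
  next
    case False
    then have "cone_norm K (T ^^ n) / 2 < (SUP x\<in>{x\<in>K. norm x \<le> 1}. norm ((T ^^ n) x))"
      using nonneg unfolding cone_norm_def[symmetric] by simp
    moreover have "{x\<in>K. norm x \<le> 1} \<noteq> {}" using zero_K by force
    ultimately obtain x where "x \<in> K" "norm x \<le> 1" "cone_norm K (T ^^ n) / 2 < norm ((T ^^ n) x)"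
      using less_cSUP_iff[OF _ bdd] by blast
    then show ?thesis by (intro bexI[of _ x]) auto
  qed
qed

text \<open>Removing the term \<open>f n\<close> from a partial sum that contains it leaves a finite
  sum of elements of \<open>K\<close>; closedness passes this to the limit.\<close>

lemma suminf_K:
  assumes "summable f" "\<And>n. f n \<in> K"
  shows "suminf f - f n \<in> K"
proof -
  have sum_K: "sum f A \<in> K" if "finite A" for A
    using that by induction (auto simp: zero_K intro: add_K assms)
  have lim: "(\<lambda>N. sum f {..<N + Suc n} - f n) \<longlonglongrightarrow> suminf f - f n"
    by (intro tendsto_intros LIMSEQ_ignore_initial_segment summable_LIMSEQ assms)
  have "sum f {..<N + Suc n} - f n = sum f ({..<N + Suc n} - {n})" for N
    by (simp add: sum_diff1)
  with limit_K[OF _ lim] sum_K show ?thesis by simp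
qed

text \<open>The growth hypothesis is stated as the negation of convergence to \<open>0\<close>; this is all that
  positivity of the Bonsall radius is used for, so the existence of the limit plays no role.\<close>

lemma exists_subeigenvector:
  assumes growth: "\<not> (\<lambda>n. root n (cone_norm K (T ^^ n))) \<longlonglongrightarrow> 0"
  shows "\<exists>\<mu>>0. \<exists>y\<in>K. norm y = 1 \<and> T y - \<mu> *\<^sub>R y \<in> K"
proof -
  define a where "a n = cone_norm K (T ^^ n)" for n
  have a_nonneg: "a n \<ge> 0" for n by (simp add: a_def cone_norm_nonneg)
  obtain c where c: "c > 0" "\<And>N. \<exists>n\<ge>N. c \<le> \<bar>root n (a n)\<bar>"
    using growth by (auto simp: LIMSEQ_iff not_less a_def[symmetric])
  have a_large: "\<exists>n\<ge>N. c ^ n \<le> a n" for N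
  proof -
    \<comment> \<open>Asking for \<open>Suc N\<close> makes \<open>n\<close> positive, so that the
      \<open>n\<close>-th power of the root is \<open>a n\<close>.\<close>
    obtain n where "n \<ge> Suc N" "c \<le> \<bar>root n (a n)\<bar>" using c(2) by blast
    then have n: "n \<ge> Suc N" "c \<le> root n (a n)" using a_nonneg[of n] by auto
    then have "c ^ n \<le> root n (a n) ^ n" using c(1) by (intro power_mono) auto
    then show ?thesis using n(1) a_nonneg by (intro exI[of _ n]) auto
  qed
  have "\<exists>x\<in>K. norm x \<le> 1 \<and> a n \<le> 2 * norm ((T ^^ n) x)" for n
    unfolding a_def by (rule cone_norm_almost_attained)
  then obtain x where x: "\<And>n. x n \<in> K" "\<And>n. norm (x n) \<le> 1"
    "\<And>n. a n \<le> 2 * norm ((T ^^ n) (x n))" by metis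
  \<comment> \<open>The geometric weights make the series converge, so a single vector
    \<open>u\<close> dominates a known multiple of every almost maximiser
    \<open>x n\<close>.\<close>
  define f where "f n = (1 / 2) ^ n *\<^sub>R x n" for n
  have fK: "f n \<in> K" for n using x by (simp add: f_def scale_K)
  have "summable f"
  proof (rule summable_comparison_test'[of "\<lambda>n. (1 / 2) ^ n" 0])
    show "summable (\<lambda>n. (1 / 2 :: real) ^ n)" by (intro summable_geometric) auto
    show "norm (f n) \<le> (1 / 2) ^ n" for n
      using mult_left_mono[OF x(2)[of n], of "(1 / 2) ^ n"] by (simp add: f_def)
  qed
  define u where "u = suminf f"
  have uf: "u - f n \<in> K" for n unfolding u_def by (rule suminf_K) fact+
  have uK: "u \<in> K" using add_K[OF uf fK, of 0 0] by simp
  \<comment> \<open>A solution \<open>v\<close> would dominate \<open>(T ^^ n) (x n)\<close> with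
    coefficient \<open>2 ^ n * \<mu> ^ Suc n\<close>. The choice \<open>c / 4\<close> turns this
    into \<open>(c / 2) ^ n * \<mu>\<close>, while \<open>a n\<close> reaches \<open>c ^ n\<close>
    for arbitrarily large \<open>n\<close>.\<close>
  define \<mu> where "\<mu> = c / 4"
  have \<mu>: "\<mu> > 0" using c(1) by (simp add: \<mu>_def)
  have "\<not> (\<exists>v\<in>K. \<mu> *\<^sub>R v = T v + u)"
  proof
    assume "\<exists>v\<in>K. \<mu> *\<^sub>R v = T v + u"
    then obtain v where v: "v \<in> K" "\<mu> *\<^sub>R v = T v + u" by blast
    have Tv: "\<mu> *\<^sub>R v - T v \<in> K" using v uK by simp
    have vu: "\<mu> ^ Suc n *\<^sub>R v - (T ^^ n) u \<in> K" for n
    proof (induction n)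
      case 0 show ?case using v T_K by simp
    next
      case (Suc n)
      have "T (\<mu> ^ Suc n *\<^sub>R v) - T ((T ^^ n) u) \<in> K"
        using Suc \<mu> v uK by (intro mono scale_K funpow_K) auto
      then have "\<mu> ^ Suc n *\<^sub>R T v - (T ^^ Suc n) u \<in> K" using v \<mu> by (simp add: homog)
      moreover have "\<mu> ^ Suc n *\<^sub>R \<mu> *\<^sub>R v - \<mu> ^ Suc n *\<^sub>R T v \<in> K"
        using \<mu> by (intro scale_diff_K Tv) auto
      ultimately show ?case using le_trans_K by (fastforce simp: mult.commute mult.left_commute)
    qed
    have vx: "((c / 2) ^ n * \<mu>) *\<^sub>R v - (T ^^ n) (x n) \<in> K" for n
    proof -
      have "(T ^^ n) u - (1 / 2) ^ n *\<^sub>R (T ^^ n) (x n) \<in> K"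
        using funpow_mono[OF fK uK uf, of n n] x by (simp add: f_def funpow_homog)
      then have "2 ^ n *\<^sub>R (\<mu> ^ Suc n *\<^sub>R v) - 2 ^ n *\<^sub>R ((1 / 2) ^ n *\<^sub>R (T ^^ n) (x n)) \<in> K"
        by (intro scale_diff_K le_trans_K[OF _ vu]) auto
      moreover have "2 ^ n * \<mu> ^ n = (c / 2) ^ n" by (simp add: \<mu>_def flip: power_mult_distrib)
      then have "2 ^ n * \<mu> ^ Suc n = (c / 2) ^ n * \<mu>" by simp
      moreover have "(2 :: real) ^ n * (1 / 2) ^ n = 1" by (simp flip: power_mult_distrib)
      ultimately show ?thesis by (simp only: scaleR_scaleR scaleR_one)
    qed
    define b where "b n = a n / (c / 2) ^ n" for n
    have b_nonneg: "b n \<ge> 0" for n using a_nonneg c(1) by (simp add: b_def)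
    have "\<exists>p\<in>K. norm p \<le> 4 / c \<and> norm (T p) = 1 \<and>
        (\<exists>s\<ge>0. s \<le> 2 * \<mu> / real (Suc N) \<and> s *\<^sub>R v - T p \<in> K)" for N
    proof -
      \<comment> \<open>A first crossing again: the least such index has a predecessor
        \<open>m\<close>, because adding \<open>b 0\<close> makes \<open>P 0\<close> fail. Then
        \<open>b m \<le> b (Suc m)\<close> controls \<open>a m\<close> by \<open>a (Suc m)\<close>,
        which bounds the preimage \<open>p\<close> of a unit vector.\<close>
      define P where "P n \<longleftrightarrow> real (Suc N) + b 0 < b n" for n
      have "\<exists>n. P n"
      proof -
        obtain N' where N': "real (Suc N) + b 0 < 2 ^ N'"
          using real_arch_pow[of 2 "real (Suc N) + b 0"] by auto
        obtain n where n: "n \<ge> N'" "c ^ n \<le> a n" using a_large by blast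
        have "(2::real) ^ N' \<le> 2 ^ n" using n(1) by (intro power_increasing) auto
        also have "\<dots> = c ^ n / (c / 2) ^ n" using c(1) by (simp add: power_divide)
        also have "\<dots> \<le> b n" using n(2) c(1) by (simp add: b_def divide_right_mono)
        finally show ?thesis using N' unfolding P_def by (intro exI[of _ n]) linarith
      qed
      then have P: "P (LEAST n. P n)" by (rule LeastI_ex)
      have "\<not> P 0" by (simp add: P_def)
      then obtain m where m: "(LEAST n. P n) = Suc m" using P by (metis not0_implies_Suc)
      then have "\<not> P m" using not_less_Least[of m P] by simp
      then have b_le: "b m \<le> b (Suc m)" using P m by (simp add: P_def)
      have b_gt: "b (Suc m) > real (Suc N)"
        using P m b_nonneg[of 0] by (simp add: P_def)
      define w where "w = norm ((T ^^ Suc m) (x (Suc m)))"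
      have a_w: "a (Suc m) \<le> 2 * w" using x(3) by (simp only: w_def)
      have a_le: "(c / 2) * a m \<le> a (Suc m)"
        using b_le c(1) by (simp add: b_def field_simps)
      have a_gt: "real (Suc N) * (c / 2) ^ Suc m < a (Suc m)"
        using b_gt c(1) by (simp add: b_def pos_less_divide_eq)
      moreover have "0 \<le> real (Suc N) * (c / 2) ^ Suc m" using c(1) by (intro mult_nonneg_nonneg) auto
      ultimately have w_pos: "w > 0" using a_w by linarith
      define p where "p = (1 / w) *\<^sub>R (T ^^ m) (x (Suc m))"
      have Tp: "T p = (1 / w) *\<^sub>R (T ^^ Suc m) (x (Suc m))"
        using w_pos x by (simp add: p_def homog funpow_K)
      have "p \<in> K" using w_pos x by (simp add: p_def scale_K funpow_K)
      moreover have "norm p \<le> 4 / c"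
      proof -
        have "norm ((T ^^ m) (x (Suc m))) \<le> a m" unfolding a_def by (intro cone_norm_upper x)
        then have "c * norm ((T ^^ m) (x (Suc m))) \<le> c * a m" using c(1) by simp
        also have "\<dots> \<le> 4 * w" using a_le a_w by linarith
        finally show ?thesis using w_pos c(1) by (simp add: p_def field_simps)
      qed
      moreover have "norm (T p) = 1" using w_pos unfolding Tp by (simp add: w_def)
      \<comment> \<open>The witness is the coefficient in \<open>vx\<close> at \<open>Suc m\<close>,
        divided by \<open>w\<close>. It is small because \<open>b (Suc m)\<close> exceeds
        \<open>Suc N\<close> and \<open>w\<close> is at least half of
        \<open>a (Suc m)\<close>.\<close>
      moreover have "\<exists>s\<ge>0. s \<le> 2 * \<mu> / real (Suc N) \<and> s *\<^sub>R v - T p \<in> K"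
      proof (intro exI[of _ "(1 / w) * ((c / 2) ^ Suc m * \<mu>)"] conjI)
        show "0 \<le> (1 / w) * ((c / 2) ^ Suc m * \<mu>)" using w_pos c(1) \<mu> by simp
        have "real (Suc N) * (c / 2) ^ Suc m \<le> 2 * w" using a_gt a_w by linarith
        then have "(real (Suc N) * (c / 2) ^ Suc m) * \<mu> \<le> (2 * w) * \<mu>"
          using \<mu> by (intro mult_right_mono) auto
        then show "(1 / w) * ((c / 2) ^ Suc m * \<mu>) \<le> 2 * \<mu> / real (Suc N)"
          using w_pos by (simp add: pos_le_divide_eq pos_divide_le_eq mult_ac del: power_Suc of_nat_Suc)
        show "((1 / w) * ((c / 2) ^ Suc m * \<mu>)) *\<^sub>R v - T p \<in> K"
          unfolding Tp scaleR_scaleR[symmetric, of "1 / w"] using w_pos by (intro scale_diff_K vx) auto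
      qed
      ultimately show ?thesis by blast
    qed
    then obtain p s where p: "\<And>N. p N \<in> K" "\<And>N. norm (p N) \<le> 4 / c" "\<And>N. norm (T (p N)) = 1"
      and s: "\<And>N. s N \<ge> 0" "\<And>N. s N \<le> 2 * \<mu> / real (Suc N)" "\<And>N. s N *\<^sub>R v - T (p N) \<in> K"
      by metis
    have s_lim: "s \<longlonglongrightarrow> 0"
    proof (rule tendsto_sandwich[of "\<lambda>_. 0" _ _ "\<lambda>N. 2 * \<mu> * inverse (real (Suc N))"])
      show "(\<lambda>N. 2 * \<mu> * inverse (real (Suc N))) \<longlonglongrightarrow> 0"
        using tendsto_mult_left[OF LIMSEQ_inverse_real_of_nat, of "2 * \<mu>"] by simp
    qed (use s in \<open>auto simp: divide_inverse\<close>)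
    obtain r z where r: "strict_mono r" "(\<lambda>n. T (p (r n))) \<longlonglongrightarrow> z" "z \<in> K"
      by (rule convergent_image_subseq[OF p(1,2)])
    have s_r: "(\<lambda>n. s (r n)) \<longlonglongrightarrow> 0"
      using LIMSEQ_subseq_LIMSEQ[OF s_lim r(1)] by (simp add: o_def)
    \<comment> \<open>The unit vectors \<open>T (p (r n))\<close> are dominated by multiples of
      \<open>v\<close> tending to 0, which forces their limit \<open>z\<close> to be 0.\<close>
    have "(\<lambda>n. s (r n) *\<^sub>R v - T (p (r n))) \<longlonglongrightarrow> 0 *\<^sub>R v - z"
      by (intro tendsto_intros s_r r)
    from limit_K[OF s(3) this] have "z = 0" using pointed[OF r(3)] by simp
    moreover have "norm z = 1" using tendsto_norm[OF r(2)] by (simp add: p LIMSEQ_const_iff)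
    ultimately show False by simp
  qed
  then show ?thesis using solution_or_subeigenvector[OF \<mu> uK] \<mu> by blast
qed

end

section \<open>Uniqueness under the boundary condition\<close>

locale superadditive_cone_map = monotone_cone_map +
  assumes superadd: "x \<in> K \<Longrightarrow> y \<in> K \<Longrightarrow> T (x + y) - (T x + T y) \<in> K"
    and boundary: "x \<in> frontier K \<Longrightarrow> x \<noteq> 0 \<Longrightarrow> \<beta> > 0 \<Longrightarrow> x - \<beta> *\<^sub>R T x \<notin> K"
begin

text \<open>At a boundary eigenvector with \<open>c > 0\<close>, taking
  \<open>\<beta> = 1 / c\<close> makes \<open>x - \<beta> *\<^sub>R T x\<close> equal to 0; with
  \<open>c = 0\<close> it equals \<open>x\<close>. Both lie in \<open>K\<close>.\<close>

lemma eigenvector_interior: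
  assumes "x \<in> K" "x \<noteq> 0" "T x = c *\<^sub>R x" "c \<ge> 0"
  shows "x \<in> interior K"
proof (rule ccontr)
  assume "x \<notin> interior K"
  then have x: "x \<in> frontier K" using assms(1) closure_subset by (auto simp: frontier_def)
  show False
  proof (cases "c = 0")
    case True
    then show False using boundary[OF x assms(2), of 1] assms by simp
  next
    case False
    then show False using boundary[OF x assms(2), of "1 / c"] assms zero_K by simp
  qed
qed

text \<open>For the largest \<open>s\<close> with \<open>z = x - s *\<^sub>R y\<close> in
  \<open>K\<close>, superadditivity puts \<open>T z\<close> below
  \<open>c *\<^sub>R x - (s * d) *\<^sub>R y\<close>. Since \<open>c \<le> d\<close>, this is below
  \<open>d *\<^sub>R z\<close>, which the boundary condition with \<open>\<beta> = 1 / d\<close>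
  permits only for \<open>z = 0\<close>.\<close>

lemma eigenvector_multiple:
  assumes x: "x \<in> interior K" "T x = c *\<^sub>R x"
    and y: "y \<in> K" "y \<noteq> 0" "T y = d *\<^sub>R y"
    and "c \<le> d" "d > 0"
  shows "\<exists>s>0. x = s *\<^sub>R y"
proof -
  define S where "S = {s. 0 \<le> s \<and> x - s *\<^sub>R y \<in> K}"
  obtain e where e: "e > 0" "cball x e \<subseteq> K"
    using x(1) mem_interior_cball by blast
  \<comment> \<open>Interiority of \<open>x\<close> provides a positive element of \<open>S\<close>,
    which later makes the maximum \<open>s\<close> positive.\<close>
  have "x - (e / norm y) *\<^sub>R y \<in> cball x e" using e(1) y(2) by (simp add: dist_norm)
  then have e_S: "e / norm y \<in> S" using e by (auto simp: S_def)
  have bdd: "bdd_above S"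
  proof (rule ccontr)
    assume "\<not> bdd_above S"
    then have "\<forall>n. \<exists>s\<in>S. real (Suc n) < s" by (auto simp: bdd_above_def not_le)
    then obtain s where s: "\<And>n. s n \<in> S" "\<And>n. real (Suc n) < s n" by metis
    have s_pos: "s n > 0" for n using s(2)[of n] by (rule less_trans[rotated]) simp
    have "(1 / s n) *\<^sub>R x - y \<in> K" for n
      using scale_diff_K[of x "s n *\<^sub>R y" "1 / s n"] s(1)[of n] s_pos[of n] by (simp add: S_def)
    moreover have "(\<lambda>n. (1 / s n) *\<^sub>R x) \<longlonglongrightarrow> 0"
    proof (rule Lim_null_comparison[of _ "\<lambda>n. inverse (real (Suc n)) * norm x"])
      have "norm ((1 / s n) *\<^sub>R x) \<le> inverse (real (Suc n)) * norm x" for n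
        using s_pos[of n] s(2)[of n]
        by (auto simp: inverse_eq_divide intro!: mult_right_mono frac_le simp del: of_nat_Suc)
      then show "\<forall>\<^sub>F n in sequentially. norm ((1 / s n) *\<^sub>R x) \<le> inverse (real (Suc n)) * norm x"
        by simp
      show "(\<lambda>n. inverse (real (Suc n)) * norm x) \<longlonglongrightarrow> 0"
        using tendsto_mult_right[OF LIMSEQ_inverse_real_of_nat, of "norm x"] by simp
    qed
    ultimately show False by (rule not_dominated[OF y(1,2)])
  qed
  have "closed S"
  proof -
    have "closed ({0..} \<inter> (\<lambda>s. x - s *\<^sub>R y) -` K)"
      by (intro closed_Int closed_atLeast closed_vimage closed_K continuous_intros)
    moreover have "S = {0..} \<inter> (\<lambda>s. x - s *\<^sub>R y) -` K" by (auto simp: S_def)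
    ultimately show ?thesis by simp
  qed
  define s where "s = Sup S"
  have s_S: "s \<in> S" using closed_contains_Sup[OF _ bdd \<open>closed S\<close>] e_S by (auto simp: s_def)
  have s_max: "s' \<le> s" if "s' \<in> S" for s' using cSup_upper[OF that bdd] by (simp add: s_def)
  have s_pos: "s > 0" using s_max[OF e_S] e(1) y(2) by (auto intro: less_le_trans[rotated])
  define z where "z = x - s *\<^sub>R y"
  have zK: "z \<in> K" using s_S by (simp add: z_def S_def)
  \<comment> \<open>From an interior point a further positive multiple of \<open>y\<close> could be
    subtracted, exceeding the maximum of \<open>S\<close>.\<close>
  have "z \<notin> interior K"
  proof
    assume "z \<in> interior K"
    then obtain e where e: "e > 0" "cball z e \<subseteq> K" using mem_interior_cball by blast
    have "z - (e / norm y) *\<^sub>R y \<in> cball z e" using e(1) y(2) by (simp add: dist_norm)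
    then have "s + e / norm y \<in> S"
      using e s_pos by (auto simp: S_def z_def algebra_simps)
    then have "e / norm y \<le> 0" using s_max by fastforce
    then show False using e(1) y(2) by (simp add: divide_le_0_iff)
  qed
  then have z_frontier: "z \<in> frontier K" using zK closure_subset by (auto simp: frontier_def)
  have syK: "s *\<^sub>R y \<in> K" using y(1) s_pos by (simp add: scale_K)
  have "T (z + s *\<^sub>R y) - (T z + T (s *\<^sub>R y)) \<in> K" by (rule superadd[OF zK syK])
  moreover have "T (z + s *\<^sub>R y) = c *\<^sub>R x" using x(2) by (simp add: z_def)
  moreover have "T (s *\<^sub>R y) = (s * d) *\<^sub>R y" using y s_pos by (simp add: homog)
  ultimately have "c *\<^sub>R x - (T z + (s * d) *\<^sub>R y) \<in> K" by simp
  moreover have "(d - c) *\<^sub>R x \<in> K" using x(1) interior_subset assms(6) by (intro scale_K) auto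
  ultimately have "(c *\<^sub>R x - (T z + (s * d) *\<^sub>R y)) + (d - c) *\<^sub>R x \<in> K" by (rule add_K)
  moreover have "(c *\<^sub>R x - (T z + (s * d) *\<^sub>R y)) + (d - c) *\<^sub>R x = d *\<^sub>R z - T z"
    by (simp add: z_def algebra_simps)
  ultimately have "d *\<^sub>R z - T z \<in> K" by simp
  then have "z - (1 / d) *\<^sub>R T z \<in> K"
    using scale_diff_K[of "d *\<^sub>R z" "T z" "1 / d"] assms(7) by simp
  then have "z = 0" using boundary[OF z_frontier, of "1 / d"] assms(7) by auto
  then show ?thesis using s_pos by (auto simp: z_def)
qed

lemma unit_eigenvector_unique:
  assumes "x \<in> K" "norm x = 1" "T x = c *\<^sub>R x" "c > 0" "unit_eigenvector K T y"
  shows "y = x"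
proof -
  obtain d where y: "y \<in> K" "norm y = 1" "T y = d *\<^sub>R y"
    using assms(5) by (auto simp: unit_eigenvector_def)
  have nz: "x \<noteq> 0" "y \<noteq> 0" using assms(2) y(2) by auto
  \<comment> \<open>A negative eigenvalue would put both \<open>y\<close> and \<open>- y\<close>
    into \<open>K\<close>.\<close>
  have "d \<ge> 0"
  proof (rule ccontr)
    assume "\<not> d \<ge> 0"
    then have "(1 / - d) *\<^sub>R T y \<in> K" using y(1) by (intro scale_K T_K) auto
    then have "- y \<in> K" using \<open>\<not> d \<ge> 0\<close> y(3) by simp
    then show False using pointed y(1) nz by blast
  qed
  then have int: "x \<in> interior K" "y \<in> interior K"
    using eigenvector_interior assms y nz by auto
  \<comment> \<open>The eigenvector with the larger eigenvalue must be the one subtracted, hence the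
    case split.\<close>
  have "\<exists>s>0. y = s *\<^sub>R x"
  proof (cases "d \<le> c")
    case True
    then show ?thesis using eigenvector_multiple[OF int(2) y(3) assms(1) nz(1) assms(3)] assms(4) by blast
  next
    case False
    then obtain s where s: "s > 0" "x = s *\<^sub>R y"
      using eigenvector_multiple[OF int(1) assms(3) y(1) nz(2) y(3)] assms(4) by auto
    then show ?thesis by (intro exI[of _ "1 / s"]) simp
  qed
  then show ?thesis using assms(2) y(2) by auto
qed

end

theorem theorem4:
  fixes K :: "'a::banach set" and T :: "'a \<Rightarrow> 'a"
  assumes "order_cone K"
    and "T ` K \<subseteq> K"
    and "superadditive_on K T"
    and "homogeneous_on K T"
    and "completely_continuous_on K T"
    and "bonsall_radius K T > 0"
  shows "\<exists>r\<^sub>0::real. \<exists>x\<^sub>0\<in>K. r\<^sub>0 > 0 \<and> norm x\<^sub>0 = 1 \<and> T x\<^sub>0 = r\<^sub>0 *\<^sub>R x\<^sub>0 \<and>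
    ((\<forall>x\<in>frontier K - {0}. \<forall>\<beta>::real. \<beta> > 0 \<longrightarrow> x - \<beta> *\<^sub>R T x \<notin> K) \<longrightarrow>
      (\<forall>x. unit_eigenvector K T x \<longleftrightarrow> x = x\<^sub>0))"
proof -
  have zero: "0 \<in> K" using assms(1) by (auto simp: order_cone_def)
  have add: "x + y \<in> K" if "x \<in> K" "y \<in> K" for x y
    using assms(1) that by (auto simp: order_cone_def)
  have superadd: "T (x + y) - (T x + T y) \<in> K" if "x \<in> K" "y \<in> K" for x y
    using assms(3) that by (auto simp: superadditive_on_def cone_le_def)
  interpret monotone_cone_map K T
  proof
    show "closed K" using assms(1) by (simp add: order_cone_def)
    show "t *\<^sub>R x \<in> K" if "x \<in> K" "0 \<le> t" for x t
      using assms(1) that by (auto simp: order_cone_def cone_def)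
    show "x = 0" if "x \<in> K" "- x \<in> K" for x
    proof -
      have "x \<in> K \<inter> uminus ` K" using that image_eqI[of x uminus "- x"] by simp
      also have "\<dots> = {0}" using assms(1) by (simp add: order_cone_def)
      finally show ?thesis by simp
    qed
    \<comment> \<open>Superadditivity at \<open>x\<close> and \<open>y - x\<close> leaves
      \<open>T y - T x\<close> above \<open>T (y - x)\<close>, which lies in
      \<open>K\<close>.\<close>
    show "T y - T x \<in> K" if "x \<in> K" "y \<in> K" "y - x \<in> K" for x y
      using add[OF superadd[OF that(1,3)], of "T (y - x)"] assms(2) that(3) by auto
  qed (use assms zero add in \<open>auto simp: homogeneous_on_def completely_continuous_on_def\<close>)
  \<comment> \<open>Convergence to 0 would give \<open>lim\<close> the value 0, against the positive
    radius.\<close>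
  have "\<not> (\<lambda>n. root n (cone_norm K (T ^^ n))) \<longlonglongrightarrow> 0"
    using assms(6) limI[of _ 0] by (metis bonsall_radius_def less_irrefl)
  then obtain r x\<^sub>0 where x\<^sub>0: "r > 0" "x\<^sub>0 \<in> K" "norm x\<^sub>0 = 1" "T x\<^sub>0 = r *\<^sub>R x\<^sub>0"
    using exists_subeigenvector eigenvector_of_subeigenvector
    by (metis norm_zero zero_neq_one)
  have "\<forall>x. unit_eigenvector K T x \<longleftrightarrow> x = x\<^sub>0"
    if "\<forall>x\<in>frontier K - {0}. \<forall>\<beta>::real. \<beta> > 0 \<longrightarrow> x - \<beta> *\<^sub>R T x \<notin> K"
  proof -
    interpret superadditive_cone_map K T
      by unfold_locales (use superadd that in auto)
    have "unit_eigenvector K T x\<^sub>0" using x\<^sub>0 by (auto simp: unit_eigenvector_def)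
    then show ?thesis using unit_eigenvector_unique x\<^sub>0 by blast
  qed
  then show ?thesis using x\<^sub>0 by blast
qed

end
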